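(* Let $l>0$ be a constant, and let $u_0,v_0,f_0\in C^1(\mathbb{R}^2)\cap C_b(\mathbb{R}^2)$ be real-valued with $f_0>0$. Consider the Cauchy problem $$\frac{\partial u}{\partial t}+u\frac{\partial u}{\partial x}+v\frac{\partial u}{\partial y}-l v=0,\qquad \frac{\partial v}{\partial t}+u\frac{\partial v}{\partial x}+v\frac{\partial v}{\partial y}+l u=0,$$ $$u(0,x,y)=u_0(x,y),\qquad v(0,x,y)=v_0(x,y),\qquad (x,y)\in\mathbb{R}^2.$$ For $\sigma>0$, $t>0$ and $(x,y)\in\mathbb{R}^2$ define $$\hat u(t,x,y)=\frac{\int_{\mathbb{R}^2} f_0(s)\,q_1(t,s)\,H(t,s,x,y)\,ds}{\int_{\mathbb{R}^2} f_0(s)\,H(t,s,x,y)\,ds},\qquad \hat v(t,x,y)=\frac{\int_{\mathbb{R}^2} f_0(s)\,q_2(t,s)\,H(t,s,x,y)\,ds}{\int_{\mathbb{R}^2} f_0(s)\,H(t,s,x,y)\,ds},$$ where $s=(s_1,s_2)$, $$q_1(t,s)=u_0(s)\cos lt-v_0(s)\sin lt,\qquad q_2(t,s)=v_0(s)\cos lt+u_0(s)\sin lt,$$ $$H(t,s,x,y)=\exp\left(-\frac{\big(q_1(t,s)-u_0(s)+s_2-y\big)^2+\big(-q_2(t,s)+v_0(s)+s_1-x\big)^2}{2\sigma^2 t}\right).$$ Then the classical solution $(u,v)$ of the Cauchy problem can be obtained from this integral asymptotic representation by passing to the limit as $\sigma\to0$: as long as the solution $(u,v)$ remains smooth, $(\hat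 u(t,x,y),\hat v(t,x,y))$ tends to $(u(t,x,y),v(t,x,y))$ as $\sigma\to 0$ for every fixed $(t,x,y)$.
   Context: $C_b(\mathbb{R}^2)$ denotes the bounded continuous functions on $\mathbb{R}^2$. The system is the two-dimensional transport equation $\partial_t \mathbf{U}+(\mathbf{U},\nabla)\mathbf{U}+lL\mathbf{U}=0$ with $\mathbf{U}=(u,v)$ and $L=\begin{pmatrix}0&-1\\1&0\end{pmatrix}$, where $l>0$ is the Coriolis parameter. The functions $\hat u,\hat v$, which depend on $\sigma$, arise as the conditional expectation of the velocity, given position, for the characteristics of the system with Brownian noise of intensity $\sigma$ added to the position equations; $f_0$ plays the role of the initial probability density of the particle position.
   Formalization: The printed formulas fail (l=1, u_0=1, v_0=0 gives v=-sin t but v̂=sin t); here q_1=u_0 cos lt+v_0 sin lt, q_2=v_0 cos lt-u_0 sin lt, and in H the terms q_1-u_0 and -q_2+v_0 are divided by l, as the characteristics of the system require. *)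

theory Defs
  imports "HOL-Analysis.Analysis"
begin

definition C1_on :: "'a::real_normed_vector set \<Rightarrow> ('a \<Rightarrow> 'b::real_normed_vector) \<Rightarrow> bool" where
  "C1_on S f \<longleftrightarrow>
     (\<exists>f' :: 'a \<Rightarrow> 'a \<Rightarrow>\<^sub>L 'b.
        (\<forall>x\<in>S. (f has_derivative blinfun_apply (f' x)) (at x within S)) \<and> continuous_on S f')"

text \<open>
  A classical solution on the time interval \<open>[0, T)\<close> is continuously differentiable up to the
  initial time, with one-sided time derivative at \<open>t = 0\<close>.
\<close>
definition classical_solution ::
  "real \<Rightarrow> (real \<times> real \<Rightarrow> real) \<Rightarrow> (real \<times> real \<Rightarrow> real) \<Rightarrow> real \<Rightarrow>
   (real \<Rightarrow> real \<Rightarrow> real \<Rightarrow> real) \<Rightarrow> (real \<Rightarrow> real \<Rightarrow> real \<Rightarrow> real) \<Rightarrow> bool" where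
  "classical_solution l u0 v0 T u v \<longleftrightarrow>
     C1_on ({0..<T} \<times> UNIV) (\<lambda>(t, x, y). u t x y) \<and>
     C1_on ({0..<T} \<times> UNIV) (\<lambda>(t, x, y). v t x y) \<and>
     (\<forall>t x y. 0 < t \<and> t < T \<longrightarrow>
        deriv (\<lambda>t'. u t' x y) t + u t x y * deriv (\<lambda>x'. u t x' y) x
          + v t x y * deriv (\<lambda>y'. u t x y') y - l * v t x y = 0 \<and>
        deriv (\<lambda>t'. v t' x y) t + u t x y * deriv (\<lambda>x'. v t x' y) x
          + v t x y * deriv (\<lambda>y'. v t x y') y + l * u t x y = 0) \<and>
     (\<forall>x y. u 0 x y = u0 (x, y) \<and> v 0 x y = v0 (x, y))"

text \<open>
  The characteristics of the system are \<open>x' = u\<close>, \<open>y' = v\<close>, \<open>u' = l v\<close>, \<open>v' = - l u\<close>.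
  For the starting point \<open>s\<close> they give the velocity \<open>(q1, q2)\<close> and the position
  \<open>(s1 - (q2 - v0) / l, s2 + (q1 - u0) / l)\<close>.  With Brownian noise of intensity \<open>\<sigma>\<close> added to the
  position, \<open>H\<close> is, up to normalisation, the density of the position at time \<open>t\<close>.

  The source prints \<open>q1\<close> and \<open>q2\<close> with \<open>- sin\<close> and \<open>+ sin\<close> respectively, and \<open>H\<close> without the
  factor \<open>1 / l\<close>.  These formulas do not belong to the system above: for the constant data
  \<open>u0 = 1\<close>, \<open>v0 = 0\<close> the solution is \<open>v = - sin (l t)\<close>, but the printed ratio for the second
  component equals \<open>sin (l t)\<close> for every \<open>\<sigma>\<close>.
\<close>
definition q1 :: "real \<Rightarrow> (real \<times> real \<Rightarrow> real) \<Rightarrow> (real \<times> real \<Rightarrow> real) \<Rightarrow> real \<Rightarrow> real \<times> real \<Rightarrow> real" where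
  "q1 l u0 v0 t s = u0 s * cos (l * t) + v0 s * sin (l * t)"

definition q2 :: "real \<Rightarrow> (real \<times> real \<Rightarrow> real) \<Rightarrow> (real \<times> real \<Rightarrow> real) \<Rightarrow> real \<Rightarrow> real \<times> real \<Rightarrow> real" where
  "q2 l u0 v0 t s = v0 s * cos (l * t) - u0 s * sin (l * t)"

definition H ::
  "real \<Rightarrow> (real \<times> real \<Rightarrow> real) \<Rightarrow> (real \<times> real \<Rightarrow> real) \<Rightarrow> real \<Rightarrow>
   real \<Rightarrow> real \<times> real \<Rightarrow> real \<Rightarrow> real \<Rightarrow> real" where
  "H l u0 v0 \<sigma> t s x y =
     exp (- ((((q1 l u0 v0 t s - u0 s) / l + snd s - y)\<^sup>2
              + ((- q2 l u0 v0 t s + v0 s) / l + fst s - x)\<^sup>2) / (2 * \<sigma>\<^sup>2 * t)))"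

definition u_hat ::
  "real \<Rightarrow> (real \<times> real \<Rightarrow> real) \<Rightarrow> (real \<times> real \<Rightarrow> real) \<Rightarrow> (real \<times> real \<Rightarrow> real) \<Rightarrow> real \<Rightarrow>
   real \<Rightarrow> real \<Rightarrow> real \<Rightarrow> real" where
  "u_hat l u0 v0 f0 \<sigma> t x y =
     (LINT s|lborel. f0 s * q1 l u0 v0 t s * H l u0 v0 \<sigma> t s x y) /
     (LINT s|lborel. f0 s * H l u0 v0 \<sigma> t s x y)"

definition v_hat ::
  "real \<Rightarrow> (real \<times> real \<Rightarrow> real) \<Rightarrow> (real \<times> real \<Rightarrow> real) \<Rightarrow> (real \<times> real \<Rightarrow> real) \<Rightarrow> real \<Rightarrow>
   real \<Rightarrow> real \<Rightarrow> real \<Rightarrow> real" where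
  "v_hat l u0 v0 f0 \<sigma> t x y =
     (LINT s|lborel. f0 s * q2 l u0 v0 t s * H l u0 v0 \<sigma> t s x y) /
     (LINT s|lborel. f0 s * H l u0 v0 \<sigma> t s x y)"

end

theory Submission
  imports Defs "HOL-Probability.Distributions"
begin

text \<open>
  The explicit characteristic from \<open>s\<close>, with position \<open>X (t, s)\<close>, carries the velocity \<open>(q1, q2)\<close>, so
  that \<open>q1 (t, s) = u (t, X (t, s))\<close>, and \<open>H\<close> is a Gaussian in \<open>X (t, s) - (x, y)\<close> of width
  proportional to \<open>\<sigma>\<close>. Thus \<open>u_hat\<close> is an average of \<open>u (t, \<cdot>)\<close> over points that concentrate at
  \<open>(x, y)\<close>. The concentration is Laplace's method and only needs some characteristic to reach
  \<open>(x, y)\<close>; this follows from Brouwer's fixed point theorem, because \<open>X (t, \<cdot>)\<close> differs from the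
  identity by a bounded continuous map.
\<close>

section \<open>Growth of solutions of differential inequalities\<close>

lemma gronwall_differential_inequality:
  fixes w w' :: "real \<Rightarrow> real"
  assumes "a \<le> b" "continuous_on {a..b} w"
    and deriv: "\<And>x. a < x \<Longrightarrow> x < b \<Longrightarrow> (w has_real_derivative w' x) (at x)"
    and growth: "\<And>x. a < x \<Longrightarrow> x < b \<Longrightarrow> w' x \<le> K * w x"
  shows "w b \<le> exp (K * (b - a)) * w a"
proof -
  have "exp (- K * b) * w b \<le> exp (- K * a) * w a"
  proof (rule DERIV_nonpos_imp_decreasing_open[OF \<open>a \<le> b\<close>])
    fix x assume x: "a < x" "x < b"
    have "((\<lambda>x. exp (- K * x) * w x) has_real_derivative exp (- K * x) * (w' x - K * w x)) (at x)"
      by (rule derivative_eq_intros deriv x refl | simp add: algebra_simps)+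
    moreover have "exp (- K * x) * (w' x - K * w x) \<le> 0"
      using growth[OF x] by (simp add: mult_le_0_iff)
    ultimately show "\<exists>y. ((\<lambda>x. exp (- K * x) * w x) has_real_derivative y) (at x) \<and> y \<le> 0"
      by blast
  qed (intro continuous_intros assms)
  then have "exp (K * b) * (exp (- K * b) * w b) \<le> exp (K * b) * (exp (- K * a) * w a)"
    by simp
  then show ?thesis
    by (simp add: mult.assoc[symmetric] exp_add[symmetric] right_diff_distrib)
qed

lemma norm_le_exp_growth:
  fixes w w' :: "real \<Rightarrow> 'a::real_inner"
  assumes "a \<le> b" "continuous_on {a..b} w"
    and deriv: "\<And>x. a < x \<Longrightarrow> x < b \<Longrightarrow> (w has_vector_derivative w' x) (at x)"
    and growth: "\<And>x. a < x \<Longrightarrow> x < b \<Longrightarrow> norm (w' x) \<le> K * norm (w x)"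
  shows "norm (w b) \<le> exp (K * (b - a)) * norm (w a)"
proof -
  have "w b \<bullet> w b \<le> exp (2 * K * (b - a)) * (w a \<bullet> w a)"
  proof (rule gronwall_differential_inequality[OF \<open>a \<le> b\<close>])
    fix x assume x: "a < x" "x < b"
    show "((\<lambda>x. w x \<bullet> w x) has_real_derivative 2 * (w x \<bullet> w' x)) (at x)"
      using has_derivative_inner[OF deriv[OF x, unfolded has_vector_derivative_def]
          deriv[OF x, unfolded has_vector_derivative_def]]
      by (rule has_derivative_imp_has_field_derivative) (simp add: inner_commute)
    have "w x \<bullet> w' x \<le> norm (w x) * norm (w' x)"
      by (rule norm_cauchy_schwarz)
    also have "\<dots> \<le> norm (w x) * (K * norm (w x))"
      by (intro mult_left_mono growth x norm_ge_zero)
    finally show "2 * (w x \<bullet> w' x) \<le> 2 * K * (w x \<bullet> w x)"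
      by (simp add: dot_square_norm power2_eq_square mult_ac)
  qed (intro continuous_intros assms)
  then have "(norm (w b))\<^sup>2 \<le> (exp (K * (b - a)) * norm (w a))\<^sup>2"
    by (simp add: dot_square_norm power_mult_distrib exp_double[symmetric] mult.assoc)
  then show ?thesis
    by (rule power2_le_imp_le) simp
qed

section \<open>Transport equations and their characteristics\<close>

lemma C1_on_imp_continuous_on:
  assumes "C1_on S f"
  shows "continuous_on S f"
  using assms unfolding C1_on_def
  by (meson continuous_on_eq_continuous_within has_derivative_continuous)

lemma C1_on_Pair:
  assumes "C1_on S f" "C1_on S g"
  shows "C1_on S (\<lambda>x. (f x, g x))"
proof -
  obtain f' g' where f': "\<And>x. x \<in> S \<Longrightarrow> (f has_derivative blinfun_apply (f' x)) (at x within S)"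
    and g': "\<And>x. x \<in> S \<Longrightarrow> (g has_derivative blinfun_apply (g' x)) (at x within S)"
    and cont: "continuous_on S f'" "continuous_on S g'"
    using assms unfolding C1_on_def by metis
  define inl where "inl = Blinfun (\<lambda>a::'b. (a, 0::'c))"
  define inr where "inr = Blinfun (\<lambda>b::'c. (0::'b, b))"
  have [simp]: "inl a = (a, 0)" "inr b = (0, b)" for a b
    unfolding inl_def inr_def
    by (subst bounded_linear_Blinfun_apply,
        intro bounded_linear_Pair bounded_linear_ident bounded_linear_zero, rule refl)+
  define D where "D x = (inl o\<^sub>L f' x) + (inr o\<^sub>L g' x)" for x
  have "blinfun_apply (D x) = (\<lambda>h. (f' x h, g' x h))" for x
    by (simp add: D_def fun_eq_iff blinfun.add_left)
  then have "((\<lambda>x. (f x, g x)) has_derivative D x) (at x within S)" if "x \<in> S" for x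
    using has_derivative_Pair[OF f'[OF that] g'[OF that]] by simp
  moreover have "continuous_on S D"
    unfolding D_def by (intro continuous_intros cont)
  ultimately show ?thesis
    unfolding C1_on_def by blast
qed

lemma has_vector_derivative_along_curve:
  assumes "(f has_derivative D) (at (\<gamma> s))" "(\<gamma> has_vector_derivative e) (at s)"
  shows "((\<lambda>s. f (\<gamma> s)) has_vector_derivative D e) (at s)"
  using vector_derivative_diff_chain_within[OF assms(2) has_derivative_at_withinI[OF assms(1)]]
  by (simp add: o_def)

lemma continuous_on_along_curve:
  fixes \<gamma> :: "real \<Rightarrow> 'a::topological_space"
  assumes "continuous_on ({0..<T} \<times> UNIV) f" "continuous_on {0..t} \<gamma>" "t < T"
  shows "continuous_on {0..t} (\<lambda>\<tau>. f (\<tau>, \<gamma> \<tau>))"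
  by (rule continuous_on_compose2[OF assms(1) continuous_on_Pair[OF continuous_on_id assms(2)]])
    (use assms(3) in auto)

text \<open>
  The equation \<open>\<partial>\<^sub>t U + (U, \<nabla>) U = A U\<close>: its left-hand side is the derivative of \<open>U\<close> in the
  direction \<open>(1, U)\<close>.
\<close>
definition transport_solution ::
  "('a::real_normed_vector \<Rightarrow> 'a) \<Rightarrow> real \<Rightarrow> (real \<times> 'a \<Rightarrow> 'a) \<Rightarrow> bool" where
  "transport_solution A T U \<longleftrightarrow>
     C1_on ({0..<T} \<times> UNIV) U \<and>
     (\<forall>t z D. 0 < t \<and> t < T \<and> (U has_derivative D) (at (t, z)) \<longrightarrow>
        D (1, U (t, z)) = A (U (t, z)))"

lemma transport_solution_imp_continuous_on:
  assumes "transport_solution A T U"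
  shows "continuous_on ({0..<T} \<times> UNIV) U"
  using assms C1_on_imp_continuous_on by (auto simp: transport_solution_def)

lemma transport_solution_imp_continuous_on_slice:
  assumes "transport_solution A T U" "0 \<le> t" "t < T"
  shows "continuous_on UNIV (\<lambda>z. U (t, z))"
  by (rule continuous_on_compose2[OF transport_solution_imp_continuous_on[OF assms(1)]
        continuous_on_Pair[OF continuous_on_const continuous_on_id]])
    (use assms in auto)

lemma transport_solution_derivative:
  fixes U :: "real \<times> 'a::real_normed_vector \<Rightarrow> 'a"
  assumes sol: "transport_solution A T U"
  obtains U' :: "real \<times> 'a \<Rightarrow> (real \<times> 'a) \<Rightarrow>\<^sub>L 'a"
  where "continuous_on ({0..<T} \<times> UNIV) U'"
    and "\<And>t z. 0 < t \<Longrightarrow> t < T \<Longrightarrow> (U has_derivative U' (t, z)) (at (t, z))"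
    and "\<And>t z. 0 < t \<Longrightarrow> t < T \<Longrightarrow> U' (t, z) (1, U (t, z)) = A (U (t, z))"
proof -
  let ?S = "{0..<T} \<times> (UNIV :: 'a set)"
  obtain U' :: "real \<times> 'a \<Rightarrow> (real \<times> 'a) \<Rightarrow>\<^sub>L 'a"
    where within: "\<And>z. z \<in> ?S \<Longrightarrow> (U has_derivative U' z) (at z within ?S)"
      and cont: "continuous_on ?S U'"
    using sol unfolding transport_solution_def C1_on_def by metis
  have U': "(U has_derivative U' (t, z)) (at (t, z))" if "0 < t" "t < T" for t z
    using within[of "(t, z)"] that at_within_interior[of "(t, z)" ?S]
    by (simp add: interior_Times)
  moreover have "U' (t, z) (1, U (t, z)) = A (U (t, z))" if "0 < t" "t < T" for t z
    using sol U'[OF that] that unfolding transport_solution_def by blast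
  ultimately show thesis
    by (rule that[OF cont])
qed

lemma transport_defect_has_vector_derivative:
  fixes U :: "real \<times> 'a::real_normed_vector \<Rightarrow> 'a"
  assumes "bounded_linear A"
    and U: "(U has_derivative D) (at (\<tau>, \<gamma> \<tau>))" "D (1, U (\<tau>, \<gamma> \<tau>)) = A (U (\<tau>, \<gamma> \<tau>))"
    and \<gamma>: "(\<gamma> has_vector_derivative q \<tau>) (at \<tau>)"
    and q: "(q has_vector_derivative A (q \<tau>)) (at \<tau>)"
  shows "((\<lambda>\<tau>. U (\<tau>, \<gamma> \<tau>) - q \<tau>) has_vector_derivative
    A (U (\<tau>, \<gamma> \<tau>) - q \<tau>) - D (0, U (\<tau>, \<gamma> \<tau>) - q \<tau>)) (at \<tau>)"
proof -
  interpret A: bounded_linear A by fact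
  interpret D: bounded_linear D using U(1) by (rule has_derivative_bounded_linear)
  let ?W = "U (\<tau>, \<gamma> \<tau>) - q \<tau>"
  have "((\<lambda>\<tau>. (\<tau>, \<gamma> \<tau>)) has_vector_derivative (1, q \<tau>)) (at \<tau>)"
    by (intro has_vector_derivative_Pair has_vector_derivative_id \<gamma>)
  with U(1) have "((\<lambda>\<tau>. U (\<tau>, \<gamma> \<tau>)) has_vector_derivative D (1, q \<tau>)) (at \<tau>)"
    by (rule has_vector_derivative_along_curve[where f = U])
  then have "((\<lambda>\<tau>. U (\<tau>, \<gamma> \<tau>) - q \<tau>) has_vector_derivative D (1, q \<tau>) - A (q \<tau>)) (at \<tau>)"
    by (rule has_vector_derivative_diff[OF _ q])
  also have "D (1, q \<tau>) = D ((1, U (\<tau>, \<gamma> \<tau>)) - (0, ?W))"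
    by simp
  also have "\<dots> - A (q \<tau>) = A ?W - D (0, ?W)"
    unfolding D.diff A.diff U(2) by simp
  finally show ?thesis .
qed

text \<open>
  No existence theory for the characteristic equations is needed: along a curve \<open>\<gamma>\<close> with
  \<open>\<gamma>'' = A \<gamma>'\<close> the defect \<open>U (\<tau>, \<gamma> \<tau>) - \<gamma>' \<tau>\<close> satisfies a linear homogeneous equation.
\<close>
lemma transport_solution_along_characteristic:
  fixes U :: "real \<times> 'a::real_inner \<Rightarrow> 'a" and \<gamma> q :: "real \<Rightarrow> 'a"
  assumes sol: "transport_solution A T U" and "bounded_linear A"
    and t: "0 \<le> t" "t < T"
    and \<gamma>: "\<And>\<tau>. (\<gamma> has_vector_derivative q \<tau>) (at \<tau>)"
    and q: "\<And>\<tau>. (q has_vector_derivative A (q \<tau>)) (at \<tau>)"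
    and initial: "U (0, \<gamma> 0) = q 0"
  shows "U (t, \<gamma> t) = q t"
proof -
  let ?S = "{0..<T} \<times> (UNIV :: 'a set)"
  interpret A: bounded_linear A by fact
  obtain U' :: "real \<times> 'a \<Rightarrow> (real \<times> 'a) \<Rightarrow>\<^sub>L 'a"
    where cont_U': "continuous_on ?S U'"
      and U': "\<And>t z. 0 < t \<Longrightarrow> t < T \<Longrightarrow> (U has_derivative U' (t, z)) (at (t, z))"
        "\<And>t z. 0 < t \<Longrightarrow> t < T \<Longrightarrow> U' (t, z) (1, U (t, z)) = A (U (t, z))"
    by (rule transport_solution_derivative[OF sol]) blast
  have cont: "continuous_on {0..t} \<gamma>" "continuous_on {0..t} q"
    using continuous_on_vector_derivative[OF has_vector_derivative_at_within[OF \<gamma>]]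
      continuous_on_vector_derivative[OF has_vector_derivative_at_within[OF q]] .
  have "bounded ((\<lambda>\<tau>. U' (\<tau>, \<gamma> \<tau>)) ` {0..t})"
    by (intro compact_imp_bounded compact_continuous_image compact_Icc
        continuous_on_along_curve[OF cont_U' cont(1) t(2)])
  then obtain K where K: "norm (U' (\<tau>, \<gamma> \<tau>)) \<le> K" if "\<tau> \<in> {0..t}" for \<tau>
    unfolding bounded_iff by blast
  obtain B where B: "\<And>z. norm (A z) \<le> norm z * B"
    using A.bounded by blast
  define W where "W \<tau> = U (\<tau>, \<gamma> \<tau>) - q \<tau>" for \<tau>
  have "norm (W t) \<le> exp ((B + K) * (t - 0)) * norm (W 0)"
  proof (rule norm_le_exp_growth[OF t(1)])
    show "continuous_on {0..t} W"
      unfolding W_def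
      by (intro continuous_on_diff cont
          continuous_on_along_curve[OF transport_solution_imp_continuous_on[OF sol] cont(1) t(2)])
    fix \<tau> assume \<tau>: "0 < \<tau>" "\<tau> < t"
    let ?D = "U' (\<tau>, \<gamma> \<tau>)"
    show "(W has_vector_derivative A (W \<tau>) - ?D (0, W \<tau>)) (at \<tau>)"
      unfolding W_def using \<tau> t
      by (intro transport_defect_has_vector_derivative[OF \<open>bounded_linear A\<close>] U' \<gamma> q) auto
    have "norm (?D (0, W \<tau>)) \<le> norm ?D * norm (W \<tau>)"
      using norm_blinfun[of ?D "(0, W \<tau>)"] by (simp add: norm_Pair)
    also have "\<dots> \<le> K * norm (W \<tau>)"
      using \<tau> by (intro mult_right_mono K) auto
    finally show "norm (A (W \<tau>) - ?D (0, W \<tau>)) \<le> (B + K) * norm (W \<tau>)"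
      using B[of "W \<tau>"] norm_triangle_ineq4[of "A (W \<tau>)" "?D (0, W \<tau>)"]
      by (simp add: algebra_simps)
  qed
  then show ?thesis
    using initial by (simp add: W_def)
qed

section \<open>The Coriolis system as a transport equation\<close>

definition coriolis :: "real \<Rightarrow> real \<times> real \<Rightarrow> real \<times> real" where
  "coriolis l z = (l * snd z, - l * fst z)"

lemma bounded_linear_coriolis: "bounded_linear (coriolis l)"
  unfolding coriolis_def
  by (intro bounded_linear_Pair bounded_linear_mult_right[THEN bounded_linear_compose]
      bounded_linear_fst bounded_linear_snd)

definition velocity_field ::
  "(real \<Rightarrow> real \<Rightarrow> real \<Rightarrow> real) \<Rightarrow> (real \<Rightarrow> real \<Rightarrow> real \<Rightarrow> real) \<Rightarrow>
   real \<times> real \<times> real \<Rightarrow> real \<times> real" where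
  "velocity_field u v = (\<lambda>(t, x, y). (u t x y, v t x y))"

lemma deriv_along_curve:
  fixes f :: "'a::real_normed_vector \<Rightarrow> real"
  assumes "(f has_derivative D) (at (\<gamma> s))" "(\<gamma> has_vector_derivative e) (at s)"
  shows "deriv (\<lambda>s. f (\<gamma> s)) s = D e"
  using has_vector_derivative_along_curve[OF assms]
  by (intro DERIV_imp_deriv) (simp add: has_real_derivative_iff_has_vector_derivative)

lemma has_derivative_eq_partial_derivs:
  fixes f :: "real \<times> real \<times> real \<Rightarrow> real"
  assumes f: "(f has_derivative D) (at (t, x, y))"
  shows "D (a, b, c) = a * deriv (\<lambda>t'. f (t', x, y)) t + b * deriv (\<lambda>x'. f (t, x', y)) x
    + c * deriv (\<lambda>y'. f (t, x, y')) y"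
proof -
  interpret D: bounded_linear D using f by (rule has_derivative_bounded_linear)
  have "deriv (\<lambda>t'. f (t', x, y)) t = D (1, 0, 0)"
    "deriv (\<lambda>x'. f (t, x', y)) x = D (0, 1, 0)"
    "deriv (\<lambda>y'. f (t, x, y')) y = D (0, 0, 1)"
    using f by (auto intro!: deriv_along_curve[where f = f] has_vector_derivative_Pair)
  moreover have "(a, b, c) = a *\<^sub>R (1, 0, 0) + b *\<^sub>R (0, 1, 0) + c *\<^sub>R (0, 0, 1)"
    by simp
  ultimately show ?thesis
    by (simp only: D.add D.scaleR real_scaleR_def)
qed

lemma classical_solution_imp_transport_solution:
  assumes "classical_solution l u0 v0 T u v"
  shows "transport_solution (coriolis l) T (velocity_field u v)"
  unfolding transport_solution_def
proof (intro conjI allI impI)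
  show "C1_on ({0..<T} \<times> UNIV) (velocity_field u v)"
    using assms C1_on_Pair[of "{0..<T} \<times> UNIV" "\<lambda>(t, x, y). u t x y" "\<lambda>(t, x, y). v t x y"]
    by (simp add: classical_solution_def velocity_field_def case_prod_beta')
next
  fix t and z :: "real \<times> real" and D
  assume "0 < t \<and> t < T \<and> (velocity_field u v has_derivative D) (at (t, z))"
  moreover obtain x y where z: "z = (x, y)" by (cases z)
  ultimately have t: "0 < t" "t < T" and D: "(velocity_field u v has_derivative D) (at (t, x, y))"
    by auto
  note partials = has_derivative_fst[OF D, THEN has_derivative_eq_partial_derivs]
    has_derivative_snd[OF D, THEN has_derivative_eq_partial_derivs]
  have "deriv (\<lambda>t'. u t' x y) t + u t x y * deriv (\<lambda>x'. u t x' y) x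
      + v t x y * deriv (\<lambda>y'. u t x y') y - l * v t x y = 0"
    "deriv (\<lambda>t'. v t' x y) t + u t x y * deriv (\<lambda>x'. v t x' y) x
      + v t x y * deriv (\<lambda>y'. v t x y') y + l * u t x y = 0"
    using assms t unfolding classical_solution_def by blast+
  with partials[of 1 "u t x y" "v t x y"]
  show "D (1, velocity_field u v (t, z)) = coriolis l (velocity_field u v (t, z))"
    by (simp add: z velocity_field_def coriolis_def prod_eq_iff)
qed

definition characteristic_velocity ::
  "real \<Rightarrow> (real \<times> real \<Rightarrow> real) \<Rightarrow> (real \<times> real \<Rightarrow> real) \<Rightarrow> real \<Rightarrow> real \<times> real \<Rightarrow> real \<times> real" where
  "characteristic_velocity l u0 v0 t s = (q1 l u0 v0 t s, q2 l u0 v0 t s)"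

definition characteristic_position ::
  "real \<Rightarrow> (real \<times> real \<Rightarrow> real) \<Rightarrow> (real \<times> real \<Rightarrow> real) \<Rightarrow> real \<Rightarrow> real \<times> real \<Rightarrow> real \<times> real" where
  "characteristic_position l u0 v0 t s =
     ((- q2 l u0 v0 t s + v0 s) / l + fst s, (q1 l u0 v0 t s - u0 s) / l + snd s)"

lemma characteristic_velocity_has_vector_derivative:
  "((\<lambda>t. characteristic_velocity l u0 v0 t s) has_vector_derivative
    coriolis l (characteristic_velocity l u0 v0 t s)) (at t)"
  unfolding characteristic_velocity_def coriolis_def q1_def q2_def
  by (intro has_vector_derivative_Pair)
    (auto intro!: derivative_eq_intros
      simp: has_real_derivative_iff_has_vector_derivative[symmetric] algebra_simps)

lemma characteristic_position_has_vector_derivative: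
  assumes "l \<noteq> 0"
  shows "((\<lambda>t. characteristic_position l u0 v0 t s) has_vector_derivative
    characteristic_velocity l u0 v0 t s) (at t)"
  unfolding characteristic_velocity_def characteristic_position_def q1_def q2_def
  by (intro has_vector_derivative_Pair)
    (use assms in \<open>auto intro!: derivative_eq_intros
      simp: has_real_derivative_iff_has_vector_derivative[symmetric] field_simps\<close>)

lemma classical_solution_along_characteristic:
  assumes "l \<noteq> 0" and sol: "classical_solution l u0 v0 T u v" and "0 \<le> t" "t < T"
  shows "velocity_field u v (t, characteristic_position l u0 v0 t s) =
    characteristic_velocity l u0 v0 t s"
proof (rule transport_solution_along_characteristic[where
      \<gamma> = "\<lambda>t. characteristic_position l u0 v0 t s" and
      q = "\<lambda>t. characteristic_velocity l u0 v0 t s"])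
  show "transport_solution (coriolis l) T (velocity_field u v)"
    by (rule classical_solution_imp_transport_solution[OF sol])
  show "velocity_field u v (0, characteristic_position l u0 v0 0 s) =
      characteristic_velocity l u0 v0 0 s"
    using sol by (cases s)
      (simp add: classical_solution_def velocity_field_def characteristic_position_def
        characteristic_velocity_def q1_def q2_def)
qed (intro bounded_linear_coriolis characteristic_position_has_vector_derivative
    characteristic_velocity_has_vector_derivative assms)+

lemma norm_characteristic_velocity:
  "norm (characteristic_velocity l u0 v0 t s) = norm (u0 s, v0 s)"
proof -
  have "(a * C + b * S)\<^sup>2 + (b * C - a * S)\<^sup>2 = (a\<^sup>2 + b\<^sup>2) * (C\<^sup>2 + S\<^sup>2)" for a b C S :: real
    by algebra
  then show ?thesis
    by (simp add: characteristic_velocity_def q1_def q2_def norm_Pair)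
qed

lemma norm_characteristic_displacement_le:
  "norm (characteristic_position l u0 v0 t s - s) \<le> 2 * norm (u0 s, v0 s) / \<bar>l\<bar>"
proof -
  let ?Q = "characteristic_velocity l u0 v0 t s"
  have "characteristic_position l u0 v0 t s - s = (1 / l) *\<^sub>R (v0 s - snd ?Q, fst ?Q - u0 s)"
    by (simp add: characteristic_position_def characteristic_velocity_def prod_eq_iff)
  moreover have "norm (v0 s - snd ?Q, fst ?Q - u0 s) = norm (?Q - (u0 s, v0 s))"
    by (cases ?Q) (simp add: norm_Pair power2_commute add.commute)
  moreover have "norm (?Q - (u0 s, v0 s)) \<le> 2 * norm (u0 s, v0 s)"
    using norm_triangle_ineq4[of ?Q "(u0 s, v0 s)"] by (simp add: norm_characteristic_velocity)
  ultimately show ?thesis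
    by (simp only: norm_scaleR) (simp add: divide_right_mono)
qed

lemma continuous_on_characteristic_position:
  assumes "l \<noteq> 0" "continuous_on UNIV u0" "continuous_on UNIV v0"
  shows "continuous_on UNIV (characteristic_position l u0 v0 t)"
  unfolding characteristic_position_def q1_def q2_def
  by (intro continuous_intros assms) (use assms in auto)

section \<open>Laplace's method\<close>

definition gibbs_average ::
  "'a measure \<Rightarrow> ('a \<Rightarrow> real) \<Rightarrow> real \<Rightarrow> ('a \<Rightarrow> 'b::{banach, second_countable_topology}) \<Rightarrow> 'b" where
  "gibbs_average M r \<kappa> q =
     (LINT s|M. exp (- \<kappa> * r s) *\<^sub>R q s) /\<^sub>R (LINT s|M. exp (- \<kappa> * r s))"

context finite_measure
begin

context
  fixes r :: "'a \<Rightarrow> real"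
  assumes r_measurable [measurable]: "r \<in> borel_measurable M" and r_nonneg: "\<And>s. r s \<ge> 0"
begin

lemma integrable_gibbs_bounded:
  fixes q :: "'a \<Rightarrow> 'b::{banach, second_countable_topology}"
  assumes [measurable]: "q \<in> borel_measurable M" and "\<kappa> \<ge> 0" "\<And>s. norm (q s) \<le> B"
  shows "integrable M (\<lambda>s. exp (- \<kappa> * r s) *\<^sub>R q s)"
proof (rule integrable_const_bound[of _ B])
  have "norm (exp (- \<kappa> * r s) *\<^sub>R q s) \<le> 1 * B" for s
    unfolding norm_scaleR using assms r_nonneg by (intro mult_mono) auto
  then show "AE s in M. norm (exp (- \<kappa> * r s) *\<^sub>R q s) \<le> B"
    by simp
qed measurable

lemma integrable_gibbs:
  assumes "\<kappa> \<ge> 0"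
  shows "integrable M (\<lambda>s. exp (- \<kappa> * r s))"
  using integrable_gibbs_bounded[of "\<lambda>_. 1 :: real" \<kappa> 1] assms by simp

lemma gibbs_integral_ge:
  assumes "\<kappa> \<ge> 0"
  shows "exp (- \<kappa> * d) * measure M {s \<in> space M. r s < d} \<le> (LINT s|M. exp (- \<kappa> * r s))"
proof -
  let ?A = "{s \<in> space M. r s < d}"
  have "exp (- \<kappa> * d) * measure M ?A = (LINT s|M. exp (- \<kappa> * d) * indicator ?A s)"
    by simp
  also have "\<dots> \<le> (LINT s|M. exp (- \<kappa> * r s))"
  proof (rule integral_mono)
    show "exp (- \<kappa> * d) * indicator ?A s \<le> exp (- \<kappa> * r s)" for s
      using assms by (auto simp: indicator_def intro: mult_left_mono)
    show "integrable M (\<lambda>s. exp (- \<kappa> * d) * indicator ?A s)"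
      by (intro integrable_mult_right integrable_real_indicator) (auto simp: less_top[symmetric])
  qed (rule integrable_gibbs[OF assms])
  finally show ?thesis .
qed

lemma gibbs_tail_integral_le:
  assumes "\<kappa> \<ge> 0"
  shows "(LINT s|M. exp (- \<kappa> * r s) * indicator {s \<in> space M. d \<le> r s} s)
    \<le> exp (- \<kappa> * d) * measure M (space M)"
proof -
  let ?A = "{s \<in> space M. d \<le> r s}"
  have "(LINT s|M. exp (- \<kappa> * r s) * indicator ?A s) \<le> (LINT s|M. exp (- \<kappa> * d))"
  proof (rule integral_mono)
    show "exp (- \<kappa> * r s) * indicator ?A s \<le> exp (- \<kappa> * d)" for s
      using assms by (auto simp: indicator_def intro: mult_left_mono)
    show "integrable M (\<lambda>s. exp (- \<kappa> * r s) * indicator ?A s)"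
      using integrable_gibbs_bounded[of "indicator ?A :: 'a \<Rightarrow> real" \<kappa> 1] assms
      by (simp add: indicator_def)
  qed simp
  then show ?thesis by (simp add: mult.commute)
qed

lemma measure_sublevel_pos:
  assumes "\<not> (AE s in M. d \<le> r s)"
  shows "measure M {s \<in> space M. r s < d} > 0"
proof -
  have "emeasure M {s \<in> space M. r s < d} \<noteq> 0"
    using assms by (subst (asm) AE_iff_measurable[OF _ refl]) (auto simp: not_le)
  then show ?thesis
    by (simp add: emeasure_eq_measure zero_less_measure_iff)
qed

lemma gibbs_integral_pos:
  assumes "\<kappa> \<ge> 0" "\<not> (AE s in M. d \<le> r s)"
  shows "(LINT s|M. exp (- \<kappa> * r s)) > 0"
proof -
  have "0 < exp (- \<kappa> * d) * measure M {s \<in> space M. r s < d}"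
    using measure_sublevel_pos[OF assms(2)] by simp
  also have "\<dots> \<le> (LINT s|M. exp (- \<kappa> * r s))"
    by (rule gibbs_integral_ge[OF assms(1)])
  finally show ?thesis .
qed

text \<open>
  The mass of \<open>{r \<ge> d}\<close> decays like \<open>exp (- \<kappa> d)\<close>, whereas the total mass is at least a constant
  times \<open>exp (- \<kappa> d / 2)\<close> because \<open>{r < d / 2}\<close> is not a null set.
\<close>
lemma gibbs_average_tail_tendsto_zero:
  assumes ess_inf: "\<not> (AE s in M. d / 2 \<le> r s)" and "d > 0"
  shows "((\<lambda>\<kappa>. gibbs_average M r \<kappa> (indicator {s \<in> space M. d \<le> r s}) :: real) \<longlongrightarrow> 0) at_top"
proof -
  let ?tail = "\<lambda>\<kappa>. gibbs_average M r \<kappa> (indicator {s \<in> space M. d \<le> r s}) :: real"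
  define m where "m = measure M {s \<in> space M. r s < d / 2}"
  have "m > 0"
    unfolding m_def by (rule measure_sublevel_pos[OF ess_inf])
  define C where "C = measure M (space M) / m"
  have upper: "?tail \<kappa> \<le> C * exp (- (d / 2 * \<kappa>))" if "\<kappa> \<ge> 0" for \<kappa>
  proof -
    have "?tail \<kappa> \<le> (exp (- \<kappa> * d) * measure M (space M)) / (exp (- \<kappa> * (d / 2)) * m)"
      using gibbs_tail_integral_le[OF that, of d] gibbs_integral_ge[OF that, of "d / 2"] \<open>m > 0\<close>
      unfolding gibbs_average_def m_def real_scaleR_def divide_inverse_commute[symmetric]
      by (intro frac_le) auto
    also have "\<dots> = C * (exp (- \<kappa> * d) / exp (- \<kappa> * (d / 2)))"
      by (simp add: C_def mult.commute)
    also have "exp (- \<kappa> * d) / exp (- \<kappa> * (d / 2)) = exp (- (d / 2 * \<kappa>))"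
      by (simp add: exp_diff[symmetric])
    finally show ?thesis .
  qed
  have "LIM \<kappa> at_top. d / 2 * \<kappa> :> at_top"
    using \<open>d > 0\<close> by (intro filterlim_tendsto_pos_mult_at_top[OF tendsto_const] filterlim_ident) simp
  then have "((\<lambda>\<kappa>. exp (- (d / 2 * \<kappa>))) \<longlongrightarrow> 0) at_top"
    by (intro filterlim_compose[OF exp_at_bot]) (simp add: filterlim_uminus_at_top[symmetric])
  then have "((\<lambda>\<kappa>. C * exp (- (d / 2 * \<kappa>))) \<longlongrightarrow> 0) at_top"
    by (rule tendsto_mult_right_zero)
  then show ?thesis
  proof (rule tendsto_sandwich[OF _ _ tendsto_const, rotated 2])
    show "\<forall>\<^sub>F \<kappa> in at_top. 0 \<le> ?tail \<kappa>"
      by (simp add: gibbs_average_def)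
    show "\<forall>\<^sub>F \<kappa> in at_top. ?tail \<kappa> \<le> C * exp (- (d / 2 * \<kappa>))"
      using eventually_ge_at_top[of 0] by eventually_elim (rule upper)
  qed
qed

lemma gibbs_average_diff_const:
  fixes q :: "'a \<Rightarrow> 'b::{banach, second_countable_topology}"
  assumes q: "q \<in> borel_measurable M" "\<And>s. norm (q s) \<le> B"
    and "\<kappa> \<ge> 0" and ess_inf: "\<not> (AE s in M. d \<le> r s)"
  shows "gibbs_average M r \<kappa> (\<lambda>s. q s - c) = gibbs_average M r \<kappa> q - c"
proof -
  let ?D = "LINT s|M. exp (- \<kappa> * r s)"
  have "integrable M (\<lambda>s. exp (- \<kappa> * r s) *\<^sub>R q s)"
    by (rule integrable_gibbs_bounded[OF q(1) \<open>\<kappa> \<ge> 0\<close> q(2)])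
  then have "(LINT s|M. exp (- \<kappa> * r s) *\<^sub>R (q s - c))
      = (LINT s|M. exp (- \<kappa> * r s) *\<^sub>R q s) - ?D *\<^sub>R c"
    unfolding scaleR_diff_right using integrable_gibbs[OF \<open>\<kappa> \<ge> 0\<close>]
    by (subst Bochner_Integration.integral_diff) auto
  moreover have "?D \<noteq> 0"
    using gibbs_integral_pos[OF \<open>\<kappa> \<ge> 0\<close> ess_inf] by simp
  ultimately show ?thesis
    by (simp add: gibbs_average_def scaleR_diff_right[of "inverse _"])
qed

lemma norm_gibbs_average_le:
  fixes q :: "'a \<Rightarrow> 'b::{banach, second_countable_topology}"
  assumes g: "g \<in> borel_measurable M" "\<And>s. \<bar>g s\<bar> \<le> B"
    and "\<kappa> \<ge> 0" and q_le: "\<And>s. s \<in> space M \<Longrightarrow> norm (q s) \<le> g s"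
  shows "norm (gibbs_average M r \<kappa> q) \<le> gibbs_average M r \<kappa> g"
proof -
  let ?D = "LINT s|M. exp (- \<kappa> * r s)"
  have int_g: "integrable M (\<lambda>s. exp (- \<kappa> * r s) * g s)"
    using integrable_gibbs_bounded[OF g(1) \<open>\<kappa> \<ge> 0\<close>, of B] g(2) by simp
  have "norm (LINT s|M. exp (- \<kappa> * r s) *\<^sub>R q s) \<le> (LINT s|M. norm (exp (- \<kappa> * r s) *\<^sub>R q s))"
    by (rule integral_norm_bound)
  also have "\<dots> \<le> (LINT s|M. exp (- \<kappa> * r s) * g s)"
    using order_trans[OF norm_ge_zero q_le] q_le by (intro integral_mono' int_g) auto
  finally have "norm (LINT s|M. exp (- \<kappa> * r s) *\<^sub>R q s) \<le> (LINT s|M. exp (- \<kappa> * r s) * g s)" .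
  moreover have "?D \<ge> 0"
    by (intro integral_nonneg_AE) simp
  ultimately show ?thesis
    by (simp add: gibbs_average_def mult_left_mono)
qed

lemma norm_gibbs_average_diff_le:
  fixes q :: "'a \<Rightarrow> 'b::{banach, second_countable_topology}"
  assumes q: "q \<in> borel_measurable M" "\<And>s. norm (q s) \<le> B"
    and "\<kappa> \<ge> 0" and ess_inf: "\<not> (AE s in M. d \<le> r s)"
    and "e \<ge> 0" and near: "\<And>s. r s < d \<Longrightarrow> norm (q s - c) \<le> e"
  shows "norm (gibbs_average M r \<kappa> q - c)
    \<le> e + (B + norm c) * gibbs_average M r \<kappa> (indicator {s \<in> space M. d \<le> r s})"
proof -
  let ?K = "B + norm c" and ?tail = "indicator {s \<in> space M. d \<le> r s} :: 'a \<Rightarrow> real"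
  have far: "norm (q s - c) \<le> ?K" for s
    using norm_triangle_ineq4[of "q s" c] q(2)[of s] by simp
  have "norm (gibbs_average M r \<kappa> q - c) = norm (gibbs_average M r \<kappa> (\<lambda>s. q s - c))"
    by (simp add: gibbs_average_diff_const[OF q \<open>\<kappa> \<ge> 0\<close> ess_inf])
  also have "\<dots> \<le> gibbs_average M r \<kappa> (\<lambda>s. ?K * ?tail s - (- e))"
  proof (rule norm_gibbs_average_le)
    show "norm (q s - c) \<le> ?K * ?tail s - (- e)" if "s \<in> space M" for s
      using near[of s] far[of s] \<open>e \<ge> 0\<close> that by (auto simp: indicator_def)
    show "\<bar>?K * ?tail s - (- e)\<bar> \<le> \<bar>?K\<bar> + e" for s
      using \<open>e \<ge> 0\<close> by (auto simp: indicator_def)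
  qed (use \<open>\<kappa> \<ge> 0\<close> in measurable)
  also have "\<dots> = gibbs_average M r \<kappa> (\<lambda>s. ?K * ?tail s) - (- e)"
    by (rule gibbs_average_diff_const[OF _ _ \<open>\<kappa> \<ge> 0\<close> ess_inf, where B = "\<bar>?K\<bar>"])
      (auto simp: indicator_def)
  also have "\<dots> = e + ?K * gibbs_average M r \<kappa> ?tail"
    by (simp add: gibbs_average_def mult.left_commute)
  finally show ?thesis .
qed

lemma gibbs_average_tendsto_finite_measure:
  fixes q :: "'a \<Rightarrow> 'b::{banach, second_countable_topology}"
  assumes q: "q \<in> borel_measurable M" "\<And>s. norm (q s) \<le> B"
    and ess_inf: "\<And>d. d > 0 \<Longrightarrow> \<not> (AE s in M. d \<le> r s)"
    and lim: "(q \<longlongrightarrow> c) (filtercomap r (nhds 0))"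
  shows "((\<lambda>\<kappa>. gibbs_average M r \<kappa> q) \<longlongrightarrow> c) at_top"
proof (rule tendstoI)
  fix e :: real assume "e > 0"
  then obtain d where "d > 0" and d: "\<And>s. dist (r s) 0 < d \<Longrightarrow> dist (q s) c < e / 2"
    using tendstoD[OF lim half_gt_zero]
    unfolding eventually_filtercomap eventually_nhds_metric by blast
  have near: "norm (q s - c) \<le> e / 2" if "r s < d" for s
    using d[of s] r_nonneg[of s] that by (simp add: dist_norm)
  let ?tail = "\<lambda>\<kappa>. gibbs_average M r \<kappa> (indicator {s \<in> space M. d \<le> r s}) :: real"
  have "((\<lambda>\<kappa>. (B + norm c) * ?tail \<kappa>) \<longlongrightarrow> 0) at_top"
    using \<open>d > 0\<close> by (intro tendsto_mult_right_zero gibbs_average_tail_tendsto_zero ess_inf) auto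
  then have "\<forall>\<^sub>F \<kappa> in at_top. (B + norm c) * ?tail \<kappa> < e / 2"
    using \<open>e > 0\<close> by (rule order_tendstoD(2)[OF _ half_gt_zero])
  with eventually_ge_at_top[of 0]
  show "\<forall>\<^sub>F \<kappa> in at_top. dist (gibbs_average M r \<kappa> q) c < e"
  proof eventually_elim
    case (elim \<kappa>)
    then show ?case
      using norm_gibbs_average_diff_le[OF q _ ess_inf[OF \<open>d > 0\<close>] _ near, of \<kappa>] \<open>e > 0\<close>
      by (simp add: dist_norm)
  qed
qed

end

end

lemma gibbs_average_density:
  assumes [measurable]: "r \<in> borel_measurable M" "q \<in> borel_measurable M" "f \<in> borel_measurable M"
    and "\<And>s. f s \<ge> 0"
  shows "gibbs_average (density M f) r \<kappa> q =
    (LINT s|M. (f s * exp (- \<kappa> * r s)) *\<^sub>R q s) /\<^sub>R (LINT s|M. f s * exp (- \<kappa> * r s))"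
  using assms by (simp add: gibbs_average_def integral_density)

lemma gibbs_average_tendsto:
  fixes r :: "'a \<Rightarrow> real" and q :: "'a \<Rightarrow> 'b::{banach, second_countable_topology}"
  assumes [measurable]: "r \<in> borel_measurable M" "q \<in> borel_measurable M"
    and r: "\<And>s. r s \<ge> 0" and q: "\<And>s. norm (q s) \<le> B"
    and int: "integrable M (\<lambda>s. exp (- r s))"
    and ess_inf: "\<And>d. d > 0 \<Longrightarrow> \<not> (AE s in M. d \<le> r s)"
    and lim: "(q \<longlongrightarrow> c) (filtercomap r (nhds 0))"
  shows "((\<lambda>\<kappa>. gibbs_average M r \<kappa> q) \<longlongrightarrow> c) at_top"
proof -
  let ?N = "density M (\<lambda>s. exp (- r s))"
  interpret N: finite_measure ?N
    using int by (intro finite_measureI) (auto simp: emeasure_density dest!: integrableD(2))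
  have shift: "gibbs_average ?N r (\<kappa> - 1) q = gibbs_average M r \<kappa> q" for \<kappa>
    by (subst gibbs_average_density)
      (simp_all add: gibbs_average_def exp_add[symmetric] left_diff_distrib)
  have "((\<lambda>\<kappa>. gibbs_average ?N r \<kappa> q) \<longlongrightarrow> c) at_top"
    using r q ess_inf lim by (intro N.gibbs_average_tendsto_finite_measure) (auto simp: AE_density)
  moreover have "LIM \<kappa> at_top. \<kappa> - 1 :> (at_top :: real filter)"
    using filterlim_tendsto_add_at_top[OF tendsto_const[of "- 1"] filterlim_ident] by simp
  ultimately show ?thesis
    unfolding shift[symmetric] by (rule filterlim_compose)
qed

section \<open>Gaussian averages\<close>

lemma surj_bounded_perturbation:
  fixes \<phi> :: "'a::euclidean_space \<Rightarrow> 'a"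
  assumes "continuous_on UNIV \<phi>" and bound: "\<And>s. norm (\<phi> s - s) \<le> C"
  shows "surj \<phi>"
proof -
  have "\<exists>s. \<phi> s = p" for p
  proof -
    have "C \<ge> 0"
      using bound norm_ge_zero order_trans by blast
    have "continuous_on (cball p (C + 1)) (\<lambda>s. p - (\<phi> s - s))"
      by (intro continuous_intros continuous_on_subset[OF assms(1)]) auto
    moreover have "norm (\<phi> s - s) \<le> C + 1" for s
      using bound[of s] by simp
    then have "(\<lambda>s. p - (\<phi> s - s)) \<in> cball p (C + 1) \<rightarrow> cball p (C + 1)"
      by (simp add: dist_norm)
    ultimately obtain s where "p - (\<phi> s - s) = s"
      using brouwer_ball[of "C + 1" p "\<lambda>s. p - (\<phi> s - s)"] \<open>C \<ge> 0\<close> by auto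
    then show ?thesis by (auto simp: algebra_simps)
  qed
  then show ?thesis by (metis surj_def)
qed

lemma integrable_gaussian_real:
  fixes c :: real
  assumes "c > 0"
  shows "integrable lborel (\<lambda>x. exp (- c * x\<^sup>2))"
proof -
  define \<sigma> where "\<sigma> = sqrt (1 / (2 * c))"
  have \<sigma>: "\<sigma> > 0" "2 * \<sigma>\<^sup>2 = 1 / c" using assms by (auto simp: \<sigma>_def)
  have "integrable lborel (\<lambda>x. sqrt (2 * pi * \<sigma>\<^sup>2) * normal_density 0 \<sigma> x)"
    by (intro integrable_mult_right integrable_normal_density \<sigma>)
  moreover have "sqrt (2 * pi * \<sigma>\<^sup>2) * normal_density 0 \<sigma> x = exp (- c * x\<^sup>2)" for x
    using assms \<sigma> by (simp add: normal_density_def field_simps)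
  ultimately show ?thesis by simp
qed

lemma integrable_gaussian:
  assumes "c > 0"
  shows "integrable lborel (\<lambda>x :: 'a::euclidean_space. exp (- c * (norm x)\<^sup>2))"
proof (rule integrableI_bounded)
  have norm_sq: "(norm x)\<^sup>2 = (\<Sum>b\<in>Basis. (x \<bullet> b)\<^sup>2)" for x :: 'a
    unfolding power2_norm_eq_inner by (subst euclidean_inner) (simp add: power2_eq_square)
  have "(\<integral>\<^sup>+ x. ennreal (norm (exp (- c * (norm x)\<^sup>2))) \<partial>(lborel :: 'a measure))
      = (\<integral>\<^sup>+ x. (\<Prod>b\<in>Basis. ennreal (exp (- c * (x \<bullet> b)\<^sup>2))) \<partial>(lborel :: 'a measure))"
    by (simp add: norm_sq prod_ennreal exp_sum[symmetric] sum_distrib_left sum_negf)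
  also have "\<dots> = (\<Prod>b\<in>(Basis :: 'a set). \<integral>\<^sup>+ y. ennreal (exp (- c * y\<^sup>2)) \<partial>lborel)"
    by (subst nn_integral_lborel_prod) auto
  also have "\<dots> < \<infinity>"
    using integrableD(2)[OF integrable_gaussian_real[OF assms]]
    by (auto simp: ennreal_prod_eq_top power_eq_top_ennreal less_top[symmetric])
  finally show "(\<integral>\<^sup>+ x. ennreal (norm (exp (- c * (norm x)\<^sup>2))) \<partial>(lborel :: 'a measure)) < \<infinity>" .
qed measurable

lemma integrable_gaussian_perturbation:
  fixes \<phi> :: "'a::euclidean_space \<Rightarrow> 'a"
  assumes "c > 0" "continuous_on UNIV \<phi>" and bound: "\<And>s. norm (\<phi> s - s) \<le> C"
  shows "integrable lborel (\<lambda>s. exp (- c * (norm (\<phi> s - p))\<^sup>2))"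
proof (rule Bochner_Integration.integrable_bound)
  let ?C = "C + norm p"
  show "integrable lborel (\<lambda>s :: 'a. exp (c * ?C\<^sup>2) * exp (- (c / 2) * (norm s)\<^sup>2))"
    using assms by (intro integrable_mult_right integrable_gaussian) auto
  have "- c * (norm (\<phi> s - p))\<^sup>2 \<le> c * ?C\<^sup>2 + - (c / 2) * (norm s)\<^sup>2" for s
  proof -
    have "norm s \<le> norm (\<phi> s - p) + ?C"
      using bound[of s] by norm
    then have "(norm s)\<^sup>2 \<le> (norm (\<phi> s - p) + ?C)\<^sup>2"
      by (intro power_mono) auto
    also have "\<dots> \<le> 2 * (norm (\<phi> s - p))\<^sup>2 + 2 * ?C\<^sup>2"
      using sum_squares_bound[of "norm (\<phi> s - p)" ?C] by (simp add: power2_sum)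
    finally have "c * (norm s)\<^sup>2 \<le> c * (2 * (norm (\<phi> s - p))\<^sup>2 + 2 * ?C\<^sup>2)"
      using \<open>c > 0\<close> by simp
    then show ?thesis by (simp add: algebra_simps)
  qed
  then show "AE s in lborel. norm (exp (- c * (norm (\<phi> s - p))\<^sup>2)) \<le>
      norm (exp (c * ?C\<^sup>2) * exp (- (c / 2) * (norm s)\<^sup>2))"
    by (simp add: exp_add[symmetric])
  show "(\<lambda>s. exp (- c * (norm (\<phi> s - p))\<^sup>2)) \<in> borel_measurable lborel"
    using borel_measurable_continuous_onI[OF assms(2)] by simp
qed

lemma not_AE_lborel_ge:
  fixes r :: "'a::euclidean_space \<Rightarrow> real"
  assumes "continuous_on UNIV r" "r s < d"
  shows "\<not> (AE s in lborel. d \<le> r s)"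
proof
  let ?S = "{s. r s < d}"
  have "open ?S"
    by (rule open_Collect_less[OF assms(1) continuous_on_const])
  assume "AE s in lborel. d \<le> r s"
  then have "?S \<in> null_sets lborel"
    using \<open>open ?S\<close> by (simp add: AE_iff_null not_le)
  then show False
    using open_not_negligible[OF \<open>open ?S\<close>] assms(2) negligible_iff_null_sets null_sets_completionI
    by blast
qed

lemma integrable_bcontfun_mult:
  fixes f g :: "'a::topological_space \<Rightarrow> real"
  assumes sets: "sets M = sets borel" and f: "f \<in> bcontfun" and g: "integrable M g"
  shows "integrable M (\<lambda>s. f s * g s)"
proof -
  obtain C where "\<bar>f s\<bar> \<le> C" for s
    using f by (auto simp: bcontfun_def bounded_iff)
  then have C: "\<bar>f s\<bar> \<le> \<bar>C\<bar>" for s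
    using abs_ge_self order_trans by blast
  have [measurable]: "f \<in> borel_measurable M"
    using f unfolding measurable_cong_sets[OF sets refl]
    by (simp add: bcontfun_def borel_measurable_continuous_onI)
  show ?thesis
  proof (rule Bochner_Integration.integrable_bound)
    show "integrable M (\<lambda>s. C * g s)"
      using g by simp
    show "AE s in M. norm (f s * g s) \<le> norm (C * g s)"
      using C by (simp add: abs_mult mult_right_mono)
  qed (use g in measurable)
qed

lemma tendsto_filtercomap_norm_power2:
  fixes \<phi> :: "'a \<Rightarrow> 'b::real_normed_vector"
  shows "(\<phi> \<longlongrightarrow> p) (filtercomap (\<lambda>s. (norm (\<phi> s - p))\<^sup>2) (nhds 0))"
proof -
  have "((\<lambda>s. sqrt ((norm (\<phi> s - p))\<^sup>2)) \<longlongrightarrow> sqrt 0)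
      (filtercomap (\<lambda>s. (norm (\<phi> s - p))\<^sup>2) (nhds 0))"
    by (intro tendsto_real_sqrt filterlim_filtercomap)
  then show ?thesis
    by (simp add: tendsto_norm_zero_iff LIM_zero_iff)
qed

lemma gaussian_average_tendsto:
  fixes \<phi> :: "'a::euclidean_space \<Rightarrow> 'a" and f :: "'a \<Rightarrow> real"
    and g :: "'a \<Rightarrow> 'b::{banach, second_countable_topology}"
  assumes \<phi>: "continuous_on UNIV \<phi>" "\<And>s. norm (\<phi> s - s) \<le> C"
    and f: "f \<in> bcontfun" "\<And>s. f s > 0"
    and g: "continuous_on UNIV g" "bounded (range (\<lambda>s. g (\<phi> s)))"
  shows "((\<lambda>\<kappa>. gibbs_average (density lborel f) (\<lambda>s. (norm (\<phi> s - p))\<^sup>2) \<kappa> (\<lambda>s. g (\<phi> s)))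
    \<longlongrightarrow> g p) at_top"
proof -
  let ?r = "\<lambda>s. (norm (\<phi> s - p))\<^sup>2"
  obtain B where B: "\<And>s. norm (g (\<phi> s)) \<le> B"
    using g(2) by (auto simp: bounded_iff)
  have cont: "continuous_on UNIV ?r" "continuous_on UNIV (\<lambda>s. g (\<phi> s))" "continuous_on UNIV f"
    using f(1) by (auto intro!: continuous_intros \<phi> continuous_on_compose2[OF g(1) \<phi>(1)]
        simp: bcontfun_def)
  note [measurable] = cont[THEN borel_measurable_continuous_onI]
  show ?thesis
  proof (rule gibbs_average_tendsto[where B = B])
    show "integrable (density lborel f) (\<lambda>s. exp (- ?r s))"
      using f(2) integrable_bcontfun_mult
        [OF sets_lborel f(1) integrable_gaussian_perturbation[OF zero_less_one \<phi>]]
      by (subst integrable_density) (auto intro: less_imp_le)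
    show "\<not> (AE s in density lborel f. d \<le> ?r s)" if "d > 0" for d
    proof -
      obtain s where "\<phi> s = p"
        using surj_bounded_perturbation[OF \<phi>] by (metis surjD)
      then show ?thesis
        using not_AE_lborel_ge[OF cont(1), of s d] that f(2) by (simp add: AE_density)
    qed
    show "((\<lambda>s. g (\<phi> s)) \<longlongrightarrow> g p) (filtercomap ?r (nhds 0))"
      by (rule continuous_on_tendsto_compose[OF g(1) tendsto_filtercomap_norm_power2]) simp_all
  qed (use B in simp_all)
qed

section \<open>The small noise limit\<close>

lemma bcontfun_Pair:
  assumes "f \<in> bcontfun" "g \<in> bcontfun"
  shows "(\<lambda>x. (f x, g x)) \<in> bcontfun"
proof -
  have "bounded (range (\<lambda>x. (f x, g x)))"
    using assms
    by (intro bounded_subset[OF bounded_Times[of "range f" "range g"]]) (auto simp: bcontfun_def)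
  then show ?thesis
    using assms by (simp add: bcontfun_def continuous_on_Pair)
qed

lemma gibbs_average_characteristic_position:
  fixes q :: "real \<times> real \<Rightarrow> real"
  assumes [measurable]: "characteristic_position l u0 v0 t \<in> borel_measurable borel"
    "q \<in> borel_measurable borel" "f0 \<in> borel_measurable borel"
    and "\<And>s. f0 s \<ge> 0"
  shows "gibbs_average (density lborel f0)
      (\<lambda>s. (norm (characteristic_position l u0 v0 t s - (x, y)))\<^sup>2) (1 / (2 * \<sigma>\<^sup>2 * t)) q =
    (LINT s|lborel. f0 s * q s * H l u0 v0 \<sigma> t s x y) /
    (LINT s|lborel. f0 s * H l u0 v0 \<sigma> t s x y)"
proof -
  let ?r = "\<lambda>s. (norm (characteristic_position l u0 v0 t s - (x, y)))\<^sup>2"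
  let ?\<kappa> = "1 / (2 * \<sigma>\<^sup>2 * t)"
  have H_eq: "exp (- ?\<kappa> * ?r s) = H l u0 v0 \<sigma> t s x y" for s
    by (simp add: H_def characteristic_position_def norm_Pair add.commute)
  have "gibbs_average (density lborel f0) ?r ?\<kappa> q =
      (LINT s|lborel. (f0 s * exp (- ?\<kappa> * ?r s)) *\<^sub>R q s) /\<^sub>R
      (LINT s|lborel. f0 s * exp (- ?\<kappa> * ?r s))"
    using assms(4) by (intro gibbs_average_density) auto
  moreover have "(f0 s * h) *\<^sub>R q s = f0 s * q s * h" for s h
    by simp
  ultimately show ?thesis
    unfolding H_eq by (simp only: real_scaleR_def divide_inverse_commute)
qed

lemma bounded_range_characteristic_velocity:
  assumes "u0 \<in> bcontfun" "v0 \<in> bcontfun"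
  shows "bounded (range (characteristic_velocity l u0 v0 t))"
  using bcontfun_Pair[OF assms]
  by (simp add: bcontfun_def bounded_iff norm_characteristic_velocity)

lemma weighted_average_along_characteristics_tendsto:
  fixes g :: "real \<times> real \<Rightarrow> real"
  assumes "l \<noteq> 0" "t > 0"
    and initial: "u0 \<in> bcontfun" "v0 \<in> bcontfun" and f0: "f0 \<in> bcontfun" "\<And>s. f0 s > 0"
    and g: "continuous_on UNIV g" "bounded (range (\<lambda>s. g (characteristic_position l u0 v0 t s)))"
  shows "((\<lambda>\<sigma>.
      (LINT s|lborel. f0 s * g (characteristic_position l u0 v0 t s) * H l u0 v0 \<sigma> t s x y) /
      (LINT s|lborel. f0 s * H l u0 v0 \<sigma> t s x y)) \<longlongrightarrow> g (x, y)) (at_right 0)"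
proof -
  let ?\<phi> = "characteristic_position l u0 v0 t"
  have \<phi>: "continuous_on UNIV ?\<phi>"
    using \<open>l \<noteq> 0\<close> initial
    by (intro continuous_on_characteristic_position) (simp_all add: bcontfun_def)
  obtain C where C: "\<And>s. norm (u0 s, v0 s) \<le> C"
    using bcontfun_Pair[OF initial] by (auto simp: bcontfun_def bounded_iff)
  have displacement: "norm (?\<phi> s - s) \<le> 2 * C / \<bar>l\<bar>" for s
  proof -
    have "norm (?\<phi> s - s) \<le> 2 * norm (u0 s, v0 s) / \<bar>l\<bar>"
      by (rule norm_characteristic_displacement_le)
    also have "\<dots> \<le> 2 * C / \<bar>l\<bar>"
      using C[of s] by (intro divide_right_mono) auto
    finally show ?thesis .
  qed
  have "LIM \<sigma> at_right 0. 1 / (2 * \<sigma>\<^sup>2 * t) :> at_top"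
    unfolding divide_inverse mult_1 using \<open>t > 0\<close>
    by (intro filterlim_compose[OF filterlim_inverse_at_top_right])
      (auto simp: filterlim_at eventually_at_filter intro!: tendsto_eq_intros)
  with gaussian_average_tendsto[OF \<phi> displacement f0 g, of "(x, y)"]
  have "((\<lambda>\<sigma>. gibbs_average (density lborel f0) (\<lambda>s. (norm (?\<phi> s - (x, y)))\<^sup>2) (1 / (2 * \<sigma>\<^sup>2 * t))
      (\<lambda>s. g (?\<phi> s))) \<longlongrightarrow> g (x, y)) (at_right 0)"
    by (auto intro: filterlim_compose)
  moreover have "?\<phi> \<in> borel_measurable borel" "(\<lambda>s. g (?\<phi> s)) \<in> borel_measurable borel"
    "f0 \<in> borel_measurable borel"
    using f0(1)
    by (auto intro!: borel_measurable_continuous_onI \<phi> continuous_on_compose2[OF g(1) \<phi>]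
        simp: bcontfun_def)
  ultimately show ?thesis
    using f0(2) by (simp add: gibbs_average_characteristic_position less_imp_le)
qed

theorem theorem2:
  fixes l T :: real
    and u0 v0 f0 :: "real \<times> real \<Rightarrow> real"
    and u v :: "real \<Rightarrow> real \<Rightarrow> real \<Rightarrow> real"
  assumes "l > 0"
    and "C1_on UNIV u0" "u0 \<in> bcontfun"
    and "C1_on UNIV v0" "v0 \<in> bcontfun"
    and "C1_on UNIV f0" "f0 \<in> bcontfun"
    and "\<And>s. f0 s > 0"
    and "classical_solution l u0 v0 T u v"
  shows "\<forall>t x y. 0 < t \<and> t < T \<longrightarrow>
    ((\<lambda>\<sigma>. (u_hat l u0 v0 f0 \<sigma> t x y, v_hat l u0 v0 f0 \<sigma> t x y)) \<longlongrightarrow> (u t x y, v t x y)) (at_right 0)"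
proof (intro allI impI)
  fix t x y assume t: "0 < t \<and> t < T"
  let ?U = "\<lambda>z. velocity_field u v (t, z)" and ?\<phi> = "characteristic_position l u0 v0 t"
  have "l \<noteq> 0" using assms(1) by simp
  have along: "?U (?\<phi> s) = characteristic_velocity l u0 v0 t s" for s
    using classical_solution_along_characteristic[OF \<open>l \<noteq> 0\<close> assms(9)] t by simp
  have "continuous_on UNIV ?U"
    using classical_solution_imp_transport_solution[OF assms(9)] t
    by (intro transport_solution_imp_continuous_on_slice) auto
  then have cont: "continuous_on UNIV (\<lambda>z. fst (?U z))" "continuous_on UNIV (\<lambda>z. snd (?U z))"
    by (auto intro: continuous_on_fst continuous_on_snd)
  have "bounded (range (\<lambda>s. ?U (?\<phi> s)))"
    using bounded_range_characteristic_velocity[OF assms(3,5)] by (simp add: along)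
  from bounded_fst[OF this] bounded_snd[OF this]
  have bdd: "bounded (range (\<lambda>s. fst (?U (?\<phi> s))))" "bounded (range (\<lambda>s. snd (?U (?\<phi> s))))"
    by (simp_all add: image_image)
  note average = weighted_average_along_characteristics_tendsto
    [OF \<open>l \<noteq> 0\<close> conjunct1[OF t] assms(3,5,7,8), of _ x y]
  have "((\<lambda>\<sigma>. u_hat l u0 v0 f0 \<sigma> t x y) \<longlongrightarrow> fst (?U (x, y))) (at_right 0)"
    using average[OF cont(1) bdd(1)] by (simp add: along characteristic_velocity_def u_hat_def)
  moreover have "((\<lambda>\<sigma>. v_hat l u0 v0 f0 \<sigma> t x y) \<longlongrightarrow> snd (?U (x, y))) (at_right 0)"
    using average[OF cont(2) bdd(2)] by (simp add: along characteristic_velocity_def v_hat_def)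
  ultimately show "((\<lambda>\<sigma>. (u_hat l u0 v0 f0 \<sigma> t x y, v_hat l u0 v0 f0 \<sigma> t x y))
      \<longlongrightarrow> (u t x y, v t x y)) (at_right 0)"
    using tendsto_Pair by (simp add: velocity_field_def)
qed

end
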